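(* For any finite abstract simplicial complex $G$ and any function $h: G\to\mathbb{R}$, the total energy $E[G]=\sum_{x\in G}h(x)$ satisfies $$E[G]=\sum_{x\in G}\sum_{y\in G}g(x,y),$$ where $g=SL^{++}S$.
   Context: A finite abstract simplicial complex $G$ is a finite set of finite non-empty sets closed under the operation of taking non-empty subsets. For $x\in G$ let $W^+(x)=\{y\in G: x\subset y\}$ (including $x$). Let $|x|$ be the cardinality of $x$, $\dim(x)=|x|-1$ and $\omega(x)=(-1)^{\dim(x)}$. For $A\subset G$ put $E[A]=\sum_{x\in A}h(x)$ (with $E[\emptyset]=0$). The matrices, indexed by $G\times G$, are $L^{++}(x,y)=E[W^+(x)\cap W^+(y)]$ and $S(x,y)=\omega(x)$ if $x=y$ and $0$ otherwise. Thus $g(x,y)=\omega(x)\omega(y)E[W^+(x)\cap W^+(y)]$. *)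

theory Defs
  imports Complex_Main
begin

definition abstract_simplicial_complex :: "'a set set \<Rightarrow> bool" where
  "abstract_simplicial_complex G \<longleftrightarrow>
     finite G \<and> (\<forall>x\<in>G. finite x \<and> x \<noteq> {}) \<and>
     (\<forall>x\<in>G. \<forall>y. y \<subseteq> x \<and> y \<noteq> {} \<longrightarrow> y \<in> G)"

(* Only applied to non-empty simplices, so the truncated subtraction is harmless. *)
definition simplex_dim :: "'a set \<Rightarrow> nat" where
  "simplex_dim x = card x - 1"

definition simplex_sign :: "'a set \<Rightarrow> real" where
  "simplex_sign x = (-1) ^ simplex_dim x"

definition upper_star :: "'a set set \<Rightarrow> 'a set \<Rightarrow> 'a set set" where
  "upper_star G x = {y \<in> G. x \<subseteq> y}"

definition energy :: "('a set \<Rightarrow> real) \<Rightarrow> 'a set set \<Rightarrow> real" where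
  "energy h A = (\<Sum>x\<in>A. h x)"

(* A G x G matrix is a function of two arguments of which only the entries with both
   indices in G are relevant; the product sums over the finite index set G. *)
definition matrix_prod_on ::
    "'i set \<Rightarrow> ('i \<Rightarrow> 'i \<Rightarrow> real) \<Rightarrow> ('i \<Rightarrow> 'i \<Rightarrow> real) \<Rightarrow> 'i \<Rightarrow> 'i \<Rightarrow> real" where
  "matrix_prod_on I A B x y = (\<Sum>z\<in>I. A x z * B z y)"

definition L_upper :: "'a set set \<Rightarrow> ('a set \<Rightarrow> real) \<Rightarrow> 'a set \<Rightarrow> 'a set \<Rightarrow> real" where
  "L_upper G h x y = energy h (upper_star G x \<inter> upper_star G y)"

definition sign_matrix :: "'a set \<Rightarrow> 'a set \<Rightarrow> real" where
  "sign_matrix x y = (if x = y then simplex_sign x else 0)"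

definition green_matrix :: "'a set set \<Rightarrow> ('a set \<Rightarrow> real) \<Rightarrow> 'a set \<Rightarrow> 'a set \<Rightarrow> real" where
  "green_matrix G h =
     matrix_prod_on G (matrix_prod_on G sign_matrix (L_upper G h)) sign_matrix"

end

theory Submission
  imports Defs
begin

text \<open>
  An entry \<open>g(x, y)\<close> is \<open>\<omega>(x) \<omega>(y)\<close> times the sum of \<open>h(z)\<close> over the simplices \<open>z\<close> having both
  \<open>x\<close> and \<open>y\<close> as faces. Summing over all \<open>x\<close> and \<open>y\<close> and exchanging the order of summation,
  the value \<open>h(z)\<close> is weighted by the square of the sum of \<open>\<omega>(x)\<close> over the faces \<open>x\<close> of \<open>z\<close>.
  As \<open>G\<close> is closed under non-empty subsets, these faces are all the non-empty subsets of \<open>z\<close>,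
  so that sum is the Euler characteristic of a full simplex, which is \<open>1\<close>
  (\<open>euler_char_full_simplex\<close>). Hence every \<open>h(z)\<close> is counted exactly once.
\<close>

text \<open>
  Expanding the product of the factors \<open>-1 + 1\<close> over the elements of \<open>z\<close> gives the alternating
  sum over all subsets of \<open>z\<close>, which vanishes because \<open>z\<close> is non-empty. The empty set contributes
  \<open>1\<close>, so the others contribute \<open>-1\<close>, and the sign of a simplex is opposite to the parity sign of
  its cardinality.
\<close>

lemma euler_char_full_simplex:
  fixes z :: "'a set"
  assumes "finite z" and "z \<noteq> {}"
  shows "(\<Sum>x\<in>Pow z - {{}}. simplex_sign x) = 1"
proof -
  have "(\<Sum>x\<in>Pow z. (-1) ^ card x :: real) = (\<Prod>a\<in>z. -1 + 1)"
    unfolding prod_add[OF \<open>finite z\<close>] by simp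
  also have "\<dots> = 0"
    using assms by (simp add: card_gt_0_iff)
  finally have "(\<Sum>x\<in>Pow z - {{}}. (-1) ^ card x :: real) = -1"
    using \<open>finite z\<close> by (simp add: sum_diff1)
  moreover have "simplex_sign x = - ((-1) ^ card x)" if "x \<in> Pow z - {{}}" for x
  proof -
    have "card x \<noteq> 0"
      using that \<open>finite z\<close> by (auto dest: finite_subset)
    then show ?thesis
      by (cases "card x") (simp_all add: simplex_sign_def simplex_dim_def)
  qed
  ultimately show ?thesis
    by (simp add: sum_negf)
qed

lemma green_matrix_entry:
  assumes "finite G" and "x \<in> G" and "y \<in> G"
  shows "green_matrix G h x y = simplex_sign x * simplex_sign y * L_upper G h x y"
proof -
  have left: "matrix_prod_on G sign_matrix (L_upper G h) x z = simplex_sign x * L_upper G h x z" for z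
  proof -
    have "matrix_prod_on G sign_matrix (L_upper G h) x z
        = (\<Sum>w\<in>G. if w = x then simplex_sign w * L_upper G h w z else 0)"
      unfolding matrix_prod_on_def by (rule sum.cong) (auto simp: sign_matrix_def)
    then show ?thesis
      using assms by simp
  qed
  have "green_matrix G h x y
      = (\<Sum>w\<in>G. matrix_prod_on G sign_matrix (L_upper G h) x w * sign_matrix w y)"
    by (simp only: green_matrix_def matrix_prod_on_def)
  also have "\<dots> = (\<Sum>w\<in>G. if w = y then simplex_sign x * L_upper G h x w * simplex_sign w else 0)"
    unfolding left by (rule sum.cong) (auto simp: sign_matrix_def)
  also have "\<dots> = simplex_sign x * simplex_sign y * L_upper G h x y"
    using assms by simp
  finally show ?thesis .
qed

theorem theorem5:
  fixes G :: "'a set set" and h :: "'a set \<Rightarrow> real"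
  assumes "abstract_simplicial_complex G"
  shows "energy h G = (\<Sum>x\<in>G. \<Sum>y\<in>G. green_matrix G h x y)"
proof -
  have fin: "finite G"
    using assms by (simp add: abstract_simplicial_complex_def)
  \<comment> \<open>Face relations become indicators, so that all sums range over \<open>G\<close> and can be exchanged.\<close>
  define s where "s x z = (if x \<subseteq> z then simplex_sign x else 0)" for x z :: "'a set"
  have entry: "green_matrix G h x y = (\<Sum>z\<in>G. h z * (s x z * s y z))" if "x \<in> G" "y \<in> G" for x y
  proof -
    have "upper_star G x \<inter> upper_star G y = {z \<in> G. x \<subseteq> z \<and> y \<subseteq> z}"
      by (auto simp: upper_star_def)
    then have "L_upper G h x y = (\<Sum>z\<in>G. if x \<subseteq> z \<and> y \<subseteq> z then h z else 0)"
      using fin by (simp add: L_upper_def energy_def sum.inter_filter)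
    then show ?thesis
      unfolding green_matrix_entry[OF fin that] sum_distrib_left
      by (auto simp: s_def sum_distrib_left intro!: sum.cong)
  qed
  have faces: "(\<Sum>x\<in>G. s x z) = 1" if "z \<in> G" for z
  proof -
    have "finite z" "z \<noteq> {}" and "{} \<notin> G"
      and closed: "\<And>x. x \<subseteq> z \<Longrightarrow> x \<noteq> {} \<Longrightarrow> x \<in> G"
      using assms that unfolding abstract_simplicial_complex_def by blast+
    have "{x \<in> G. x \<subseteq> z} = Pow z - {{}}"
      using \<open>{} \<notin> G\<close> closed by blast
    then have "(\<Sum>x\<in>G. s x z) = (\<Sum>x\<in>Pow z - {{}}. simplex_sign x)"
      by (simp only: s_def sum.inter_filter[OF fin, symmetric])
    also have "\<dots> = 1"
      using \<open>finite z\<close> \<open>z \<noteq> {}\<close> by (rule euler_char_full_simplex)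
    finally show ?thesis .
  qed
  have "(\<Sum>x\<in>G. \<Sum>y\<in>G. green_matrix G h x y) = (\<Sum>x\<in>G. \<Sum>y\<in>G. \<Sum>z\<in>G. h z * (s x z * s y z))"
    by (intro sum.cong refl entry)
  also have "\<dots> = (\<Sum>x\<in>G. \<Sum>z\<in>G. \<Sum>y\<in>G. h z * (s x z * s y z))"
    by (intro sum.cong refl sum.swap)
  also have "\<dots> = (\<Sum>z\<in>G. \<Sum>x\<in>G. \<Sum>y\<in>G. h z * (s x z * s y z))"
    by (rule sum.swap)
  also have "\<dots> = (\<Sum>z\<in>G. h z * ((\<Sum>x\<in>G. s x z) * (\<Sum>y\<in>G. s y z)))"
    by (simp only: sum_product) (simp only: sum_distrib_left)
  also have "\<dots> = energy h G"
    by (simp add: faces energy_def)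
  finally show ?thesis
    by simp
qed

end
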